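(* Let $c\in(0,1)$. (i) If $\beta\ge 1$, then $$\|\Delta f\|_{c,\beta}\le\Big(1+\frac{1}{\sqrt{c}}\Big)\,\|f\|_{c,\beta}\qquad\text{for all } f\in\ell_2(c,\beta),$$ and for $\beta=1$ the constant $1+\frac{1}{\sqrt{c}}$ cannot be replaced by a smaller one. (ii) If $0<\beta\le 1$, then $$\|\Delta f\|_{c,\beta}\le\Big(1+\frac{1}{\sqrt{\beta c}}\Big)\,\|f\|_{c,\beta}\qquad\text{for all } f\in\ell_2(c,\beta).$$
   Context: $\mathbb{N}_0=\{0,1,2,\ldots\}$. For $c\in(0,1)$ and $\beta>0$, and for $f:\mathbb{N}_0\to\mathbb{R}$ (a real sequence $(f(0),f(1),\ldots)$), put $$\|f\|_{c,\beta}=\Big(\sum_{k=0}^{\infty}\frac{(\beta)_k}{k!}\,c^k\,[f(k)]^2\Big)^{1/2},$$ where $(\beta)_k=\beta(\beta+1)\cdots(\beta+k-1)$ for $k\ge1$ and $(\beta)_0=1$. $\ell_2(c,\beta)$ is the Hilbert space of real-valued functions $f$ on $\mathbb{N}_0$ with $\|f\|_{c,\beta}<\infty$. The forward difference operator is $\Delta f(x):=f(x+1)-f(x)$, $x\in\mathbb{N}_0$. *)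

theory Defs
  imports "HOL-Analysis.Analysis"
begin

definition wt_term :: "real \<Rightarrow> real \<Rightarrow> (nat \<Rightarrow> real) \<Rightarrow> nat \<Rightarrow> real" where
  "wt_term c \<beta> f k = pochhammer \<beta> k / fact k * c ^ k * (f k)\<^sup>2"

(* For 0 < c and 0 < \<beta> the terms are nonnegative, so summability says exactly that the norm is finite. *)
definition ell2 :: "real \<Rightarrow> real \<Rightarrow> (nat \<Rightarrow> real) set" where
  "ell2 c \<beta> = {f. summable (wt_term c \<beta> f)}"

(* Meaningful only on ell2: suminf has no intended value on a divergent series, so a bound
   on this norm has to be accompanied by membership in ell2. *)
definition ell2_norm :: "real \<Rightarrow> real \<Rightarrow> (nat \<Rightarrow> real) \<Rightarrow> real" where
  "ell2_norm c \<beta> f = sqrt (\<Sum>k. wt_term c \<beta> f k)"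

definition fwd_diff :: "(nat \<Rightarrow> real) \<Rightarrow> nat \<Rightarrow> real" where
  "fwd_diff f x = f (x + 1) - f x"

end

theory Submission
  imports Defs
begin

text \<open>The ratio of consecutive weights is $c(\beta+k)/(k+1)$, which is at least $c$ for
  $\beta \ge 1$ and at least $\beta c$ for $\beta \le 1$; this bounds the norm of the shift.
  For $\beta = 1$ the alternating geometric sequences $f(k) = (-r)^k$ with $r < 1/\sqrt c$ are
  eigenvectors of the forward difference with eigenvalue $-(1+r)$, which gives sharpness.\<close>

text \<open>Young's inequality: the slack is the square \<open>(s * b + a)\<^sup>2 / s\<close>,
  which vanishes for \<open>a = - s * b\<close>. The two coefficients are tuned to a shift of norm
  at most \<open>s\<close>, since (1 + s) + (1 + 1/s) s^2 = (1 + s)^2.\<close>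

lemma square_diff_le_weighted:
  fixes a b s :: real
  assumes "s > 0"
  shows "(a - b)\<^sup>2 \<le> (1 + s) * b\<^sup>2 + (1 + 1 / s) * a\<^sup>2"
proof -
  have "(1 + s) * b\<^sup>2 + (1 + 1 / s) * a\<^sup>2 - (a - b)\<^sup>2 = (s * b + a)\<^sup>2 / s"
    using assms by (simp add: field_simps power2_eq_square)
  moreover have "(s * b + a)\<^sup>2 / s \<ge> 0"
    using assms by simp
  ultimately show ?thesis by linarith
qed

text \<open>The second condition on \<open>w\<close> makes the shift an operator of norm at most
  \<open>s\<close>, so \<open>1 + s\<close> is the triangle inequality for shift minus identity.
  Working pointwise with Young's inequality gives one majorant series \<open>?g\<close> that yields
  both summability and the bound.\<close>

lemma weighted_fwd_diff_bound:
  fixes w f :: "nat \<Rightarrow> real" and s :: real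
  assumes s: "s > 0"
    and w: "\<And>k. 0 \<le> w k" "\<And>k. w k \<le> s\<^sup>2 * w (Suc k)"
    and sm: "summable (\<lambda>k. w k * (f k)\<^sup>2)"
  shows "summable (\<lambda>k. w k * (fwd_diff f k)\<^sup>2)"
    and "(\<Sum>k. w k * (fwd_diff f k)\<^sup>2) \<le> (1 + s)\<^sup>2 * (\<Sum>k. w k * (f k)\<^sup>2)"
proof -
  let ?t = "\<lambda>k. w k * (f k)\<^sup>2"
  let ?g = "\<lambda>k. (1 + s) * ?t k + (1 + 1 / s) * s\<^sup>2 * ?t (Suc k)"
  have sm': "summable (\<lambda>k. ?t (Suc k))"
    using sm by (subst summable_Suc_iff)
  have sg: "summable ?g"
    by (intro summable_add summable_mult sm sm')
  have le: "w k * (fwd_diff f k)\<^sup>2 \<le> ?g k" for k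
  proof -
    have "w k * (fwd_diff f k)\<^sup>2 \<le> w k * ((1 + s) * (f k)\<^sup>2 + (1 + 1 / s) * (f (Suc k))\<^sup>2)"
      using square_diff_le_weighted[OF s] w(1) by (simp add: fwd_diff_def mult_left_mono)
    also have "\<dots> = (1 + s) * ?t k + (1 + 1 / s) * (f (Suc k))\<^sup>2 * w k"
      by (simp add: algebra_simps)
    also have "\<dots> \<le> (1 + s) * ?t k + (1 + 1 / s) * (f (Suc k))\<^sup>2 * (s\<^sup>2 * w (Suc k))"
      using s w(2)[of k] by (intro add_left_mono mult_left_mono) auto
    finally show ?thesis by (simp add: mult_ac)
  qed
  show sd: "summable (\<lambda>k. w k * (fwd_diff f k)\<^sup>2)"
    by (rule summable_comparison_test'[OF sg, of 0]) (use le w(1) in auto)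
  have "(\<Sum>k. w k * (fwd_diff f k)\<^sup>2) \<le> (\<Sum>k. ?g k)"
    by (rule suminf_le[OF le sd sg])
  also have "\<dots> = (1 + s) * (\<Sum>k. ?t k) + (1 + 1 / s) * s\<^sup>2 * (\<Sum>k. ?t (Suc k))"
    by (simp only: suminf_add[symmetric] suminf_mult summable_mult sm sm')
  \<comment> \<open>The shifted series lacks only the term at 0, which is nonnegative.\<close>
  also have "\<dots> \<le> (1 + s) * (\<Sum>k. ?t k) + (1 + 1 / s) * s\<^sup>2 * (\<Sum>k. ?t k)"
    using s w(1)[of 0] suminf_split_head[OF sm] by (intro add_left_mono mult_left_mono) auto
  also have "\<dots> = (1 + s)\<^sup>2 * (\<Sum>k. ?t k)"
    using s by (simp add: field_simps power2_eq_square)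
  finally show "(\<Sum>k. w k * (fwd_diff f k)\<^sup>2) \<le> (1 + s)\<^sup>2 * (\<Sum>k. ?t k)" .
qed

text \<open>Here \<open>q\<close> is a uniform lower bound for the ratio c(\<beta> + k)/(k + 1) of
  consecutive weights, so the shift has norm at most \<open>1 / sqrt q\<close>. Both upper bounds of
  the theorem are instances, with q = c and q = \<beta>c.\<close>

lemma ell2_fwd_diff_bound:
  fixes c \<beta> q :: real
  assumes "0 < c" "0 < \<beta>" "0 < q"
    and q: "\<And>k::nat. q * real (Suc k) \<le> c * (\<beta> + real k)"
    and f: "f \<in> ell2 c \<beta>"
  shows "fwd_diff f \<in> ell2 c \<beta> \<and>
    ell2_norm c \<beta> (fwd_diff f) \<le> (1 + 1 / sqrt q) * ell2_norm c \<beta> f"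
proof -
  define w where "w k = pochhammer \<beta> k / fact k * c ^ k" for k
  have wt: "wt_term c \<beta> h = (\<lambda>k. w k * (h k)\<^sup>2)" for h
    by (simp add: wt_term_def w_def fun_eq_iff)
  have w0: "0 \<le> w k" for k
    using assms by (simp add: w_def pochhammer_nonneg)
  have w1: "w k \<le> (1 / sqrt q)\<^sup>2 * w (Suc k)" for k
  proof -
    have "w k * (q * real (Suc k)) \<le> w k * (c * (\<beta> + real k))"
      by (rule mult_left_mono[OF q w0])
    \<comment> \<open>The recurrence of the weights, from (\<beta>)_{k+1} = (\<beta>)_k (\<beta> +
      k).\<close>
    also have "\<dots> = real (Suc k) * w (Suc k)"
      by (simp add: w_def pochhammer_Suc field_simps del: of_nat_Suc)
    finally have "w k * q \<le> w (Suc k)"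
      by (simp add: mult_ac del: of_nat_Suc)
    thus ?thesis
      using \<open>0 < q\<close> by (simp add: power_divide field_simps)
  qed
  have s: "1 / sqrt q > 0" using \<open>0 < q\<close> by simp
  have sm: "summable (\<lambda>k. w k * (f k)\<^sup>2)"
    using f by (simp add: ell2_def wt)
  note b = weighted_fwd_diff_bound[OF s w0 w1 sm]
  have "ell2_norm c \<beta> (fwd_diff f) \<le> sqrt ((1 + 1 / sqrt q)\<^sup>2 * (\<Sum>k. w k * (f k)\<^sup>2))"
    using b(2) by (simp add: ell2_norm_def wt)
  also have "\<dots> = (1 + 1 / sqrt q) * ell2_norm c \<beta> f"
    using s by (simp add: ell2_norm_def wt real_sqrt_mult)
  finally show ?thesis using b(1) by (simp add: ell2_def wt)
qed

text \<open>For \<beta> = 1 the weights are c^k because (1)_k = k!, so the squared norm is a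
  geometric series of ratio c r^2. The bound on \<open>r\<close> is exactly what makes it
  converge.\<close>

lemma ell2_one_alternating_geometric:
  fixes c r :: real
  assumes "0 < c" "0 < r" "r < 1 / sqrt c"
  defines "f \<equiv> \<lambda>k. (- r) ^ k"
  shows "f \<in> ell2 c 1" "ell2_norm c 1 f > 0"
    "ell2_norm c 1 (fwd_diff f) = (1 + r) * ell2_norm c 1 f"
proof -
  have "r\<^sup>2 < (1 / sqrt c)\<^sup>2"
    using assms by (intro power_strict_mono) auto
  hence lt: "c * r\<^sup>2 < 1"
    using assms by (simp add: power_divide field_simps)
  have wt: "wt_term c 1 f = (\<lambda>k. (c * r\<^sup>2) ^ k)"
    by (simp add: wt_term_def f_def fun_eq_iff pochhammer_fact[symmetric] power_mult_distrib
        flip: power_mult) (simp add: mult.commute)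
  have sm: "summable (wt_term c 1 f)"
    unfolding wt using assms lt by (intro summable_geometric) auto
  thus "f \<in> ell2 c 1" by (simp add: ell2_def)
  show "ell2_norm c 1 f > 0"
    unfolding ell2_norm_def wt using assms(1) lt by (simp add: suminf_geometric)
  have "wt_term c 1 (fwd_diff f) = (\<lambda>k. (1 + r)\<^sup>2 * wt_term c 1 f k)"
    by (simp add: wt_term_def fwd_diff_def f_def fun_eq_iff power2_eq_square algebra_simps add_divide_distrib)
  hence "ell2_norm c 1 (fwd_diff f) = sqrt ((1 + r)\<^sup>2 * (\<Sum>k. wt_term c 1 f k))"
    by (simp add: ell2_norm_def suminf_mult[OF sm])
  thus "ell2_norm c 1 (fwd_diff f) = (1 + r) * ell2_norm c 1 f"
    using assms by (simp add: ell2_norm_def real_sqrt_mult)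
qed

theorem theorem1p3:
  fixes c :: real
  assumes "0 < c" and "c < 1"
  shows
    "(\<forall>\<beta>::real. 1 \<le> \<beta> \<longrightarrow>
        (\<forall>f \<in> ell2 c \<beta>. fwd_diff f \<in> ell2 c \<beta> \<and>
           ell2_norm c \<beta> (fwd_diff f) \<le> (1 + 1 / sqrt c) * ell2_norm c \<beta> f))
     \<and> \<not> (\<exists>C::real. C < 1 + 1 / sqrt c \<and>
           (\<forall>f \<in> ell2 c 1. ell2_norm c 1 (fwd_diff f) \<le> C * ell2_norm c 1 f))
     \<and> (\<forall>\<beta>::real. 0 < \<beta> \<and> \<beta> \<le> 1 \<longrightarrow>
        (\<forall>f \<in> ell2 c \<beta>. fwd_diff f \<in> ell2 c \<beta> \<and>
           ell2_norm c \<beta> (fwd_diff f) \<le> (1 + 1 / sqrt (\<beta> * c)) * ell2_norm c \<beta> f))"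
proof (intro conjI allI impI ballI notI)
  fix \<beta> :: real and f assume "1 \<le> \<beta>" "f \<in> ell2 c \<beta>"
  \<comment> \<open>With q = c the ratio condition reduces to k + 1 \<le> \<beta> + k.\<close>
  then have *: "fwd_diff f \<in> ell2 c \<beta> \<and>
    ell2_norm c \<beta> (fwd_diff f) \<le> (1 + 1 / sqrt c) * ell2_norm c \<beta> f"
    using assms by (intro ell2_fwd_diff_bound) auto
  show "fwd_diff f \<in> ell2 c \<beta>"
    and "ell2_norm c \<beta> (fwd_diff f) \<le> (1 + 1 / sqrt c) * ell2_norm c \<beta> f"
    using * by auto
next
  fix \<beta> :: real and f assume \<beta>: "0 < \<beta> \<and> \<beta> \<le> 1" and f: "f \<in> ell2 c \<beta>"
  \<comment> \<open>The ratio condition for q = \<beta>c; after cancelling c it reads \<beta>k \<le>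
    k.\<close>
  have "\<beta> * c * real (Suc k) \<le> c * (\<beta> + real k)" for k
  proof -
    have "\<beta> * real k \<le> 1 * real k" using \<beta> by (intro mult_right_mono) auto
    hence "c * (\<beta> * real (Suc k)) \<le> c * (\<beta> + real k)"
      using assms by (intro mult_left_mono) (auto simp: algebra_simps)
    thus ?thesis by (simp add: mult_ac)
  qed
  then have *: "fwd_diff f \<in> ell2 c \<beta> \<and>
    ell2_norm c \<beta> (fwd_diff f) \<le> (1 + 1 / sqrt (\<beta> * c)) * ell2_norm c \<beta> f"
    using assms \<beta> f by (intro ell2_fwd_diff_bound) auto
  show "fwd_diff f \<in> ell2 c \<beta>"
    and "ell2_norm c \<beta> (fwd_diff f) \<le> (1 + 1 / sqrt (\<beta> * c)) * ell2_norm c \<beta> f"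
    using * by auto
next
  assume "\<exists>C::real. C < 1 + 1 / sqrt c \<and>
    (\<forall>f \<in> ell2 c 1. ell2_norm c 1 (fwd_diff f) \<le> C * ell2_norm c 1 f)"
  then obtain C where C: "C < 1 + 1 / sqrt c"
    "\<And>f. f \<in> ell2 c 1 \<Longrightarrow> ell2_norm c 1 (fwd_diff f) \<le> C * ell2_norm c 1 f"
    by blast
  \<comment> \<open>The maximum with 0 keeps \<open>r\<close> positive even when C < 1; r > C - 1
    makes the eigenvalue modulus 1 + r exceed C.\<close>
  have "max 0 (C - 1) < 1 / sqrt c" using C(1) assms by auto
  then obtain r where r: "max 0 (C - 1) < r" "r < 1 / sqrt c"
    using dense by blast
  then have "0 < r" by simp
  note g = ell2_one_alternating_geometric[OF assms(1) \<open>0 < r\<close> r(2)]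
  \<comment> \<open>The positive norm of the eigenvector is cancelled.\<close>
  have "1 + r \<le> C" using C(2)[OF g(1)] g(2,3) by simp
  with r(1) show False by simp
qed

end
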